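(* Let $F$ be a field of characteristic $0$. Let $R$ be a Rota--Baxter operator of weight $1$ on $F[x,y]$ of the form $R(x^ny^m)=\alpha_{n,m}y^{n+m}$, $\alpha_{n,m}\in F$ ($n,m\in\mathbb{N}$), with $\mathrm{Im}\,R\not\subseteq F1$. Suppose that $\alpha_{1,0} = \alpha_{1,2} \neq \alpha_{1,1}$. Then for all $k\geq 1$, $n\geq 0$, $$R(x^k y^n) = (-1)^{k+1}\, \alpha_{1,0}^{\,k- \varepsilon} \left( \frac{(n-k)\alpha_{1,0} + 2k\alpha_{1,1}}{n + k} \right)^{\varepsilon} y^{k+n},$$ where $\varepsilon=\varepsilon(k,n)\in\{0,1\}$ is the residue of $n-k-1$ modulo $2$; and $R(y^n)=-y^n$ for all $n>0$.
   Context: $\mathbb{N}=\{0,1,2,\ldots\}$, and $\mu^0=1$ for every $\mu\in F$ (in particular $0^0=1$). $F1$ is the set of constant polynomials. A linear operator $R$ on an algebra $A$ over $F$ is a Rota--Baxter operator of weight $\lambda\in F$ if $R(a)R(b)=R\big(R(a)b+aR(b)+\lambda ab\big)$ for all $a,b\in A$. *)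

theory Defs
  imports "HOL-Computational_Algebra.Polynomial"
begin

text \<open>
  The algebra \<open>F[x,y]\<close> is rendered as \<open>F[y][x]\<close>, i.e. as the type \<open>'a poly poly\<close>: the outer
  variable is \<open>x\<close>, the inner one is \<open>y\<close>, and \<open>F\<close> embeds as the doubly constant polynomials.
\<close>

definition scale2 :: "'a::field \<Rightarrow> 'a poly poly \<Rightarrow> 'a poly poly" where
  "scale2 c p = smult [:c:] p"

definition varx :: "'a::field poly poly" where
  "varx = [:0, 1:]"

definition vary :: "'a::field poly poly" where
  "vary = [:[:0, 1:]:]"

definition const2 :: "'a::field \<Rightarrow> 'a poly poly" where
  "const2 c = [:[:c:]:]"

definition rota_baxter :: "('a::field \<Rightarrow> 'b::ring \<Rightarrow> 'b) \<Rightarrow> 'a \<Rightarrow> ('b \<Rightarrow> 'b) \<Rightarrow> bool" where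
  "rota_baxter scale lam R \<longleftrightarrow>
     Vector_Spaces.linear scale scale R \<and>
     (\<forall>a b. R a * R b = R (R a * b + a * R b + scale lam (a * b)))"

definition eps :: "nat \<Rightarrow> nat \<Rightarrow> nat" where
  "eps k n = nat ((int n - int k - 1) mod 2)"

lemma scale2_conv_const2: "scale2 c p = const2 c * p"
  by (simp add: scale2_def const2_def)

lemma monomial_conv_monom: "varx ^ n * vary ^ m = monom (monom 1 m) n"
proof -
  have "vary ^ m = [:(monom 1 m :: 'a poly):]"
    by (simp add: vary_def poly_const_pow monom_altdef)
  moreover have "(varx :: 'a poly poly) ^ n = monom 1 n"
    by (simp add: varx_def monom_altdef)
  ultimately show ?thesis
    by (simp add: smult_monom)
qed

lemma vector_space_scale2: "vector_space scale2"
  by unfold_locales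
    (simp_all add: scale2_def smult_add_right mult.commute flip: one_pCons smult_add_left)

end

theory Submission
  imports Defs
begin

text \<open>
  Comparing coefficients in the Rota--Baxter identity for two monomials turns the problem into a
  quadratic recurrence for the array \<open>\<alpha>\<close>, recorded below as \<open>rb_array\<close>. Since index
  pairs are added, an entry \<open>\<alpha> k n\<close> with \<open>k \<ge> 2\<close> is expressed through rows of smaller index,
  once for each splitting of \<open>(k, n)\<close> into pairs from positive rows. Agreement of these
  expressions constrains the smaller rows, and any one of them computes the larger.

  Row \<open>0\<close>: its entries lie in \<open>{0, -1}\<close>, and if \<open>\<alpha> 0 1\<close> were \<open>0\<close>, additivity would force the
  whole row beyond \<open>\<alpha> 0 0\<close> to vanish, which in turn annihilates row \<open>1\<close>; this contradicts
  \<open>\<alpha> 1 2 \<noteq> \<alpha> 1 1\<close>. Hence \<open>\<alpha> 0 n = -1\<close> for \<open>n > 0\<close> (\<open>rb_array_row0\<close>).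

  Row \<open>1\<close>: write \<open>c = \<alpha> 1 0\<close> and \<open>d = \<alpha> 1 1\<close>. Computing \<open>\<alpha> 2 n\<close> from the splittings
  \<open>(1,0) + (1,n)\<close> and \<open>(1,1) + (1,n-1)\<close> gives a linear equation for \<open>\<alpha> 1 (n+1)\<close> whose leading
  coefficient is a nonzero rational multiple of \<open>d - c\<close> for every \<open>n \<ge> 2\<close>. For \<open>n = 1\<close> the two
  splittings coincide and give nothing, which is why \<open>\<alpha> 1 2\<close> has to be prescribed. This
  determines the whole row (\<open>rb_array_row1\<close>).

  Higher rows: the splitting \<open>(1,0) + (k,n)\<close> expresses row \<open>k+1\<close> through rows \<open>1\<close> and \<open>k\<close>, so the
  closed form follows by induction on \<open>k\<close> (\<open>rb_array_closed_form\<close>).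
\<close>

text \<open>
  The equation between the coefficients of \<open>y ^ (n + m + p + q)\<close> in the weight \<open>1\<close> identity for
  \<open>x ^ n * y ^ m\<close> and \<open>x ^ p * y ^ q\<close>.
\<close>

definition rb_array :: "(nat \<Rightarrow> nat \<Rightarrow> 'a::comm_ring_1) \<Rightarrow> bool" where
  "rb_array \<alpha> \<longleftrightarrow> (\<forall>n m p q. \<alpha> n m * \<alpha> p q =
     \<alpha> n m * \<alpha> p (n + m + q) + \<alpha> p q * \<alpha> n (m + p + q) + \<alpha> (n + p) (m + q))"

lemma rb_arrayD:
  "rb_array \<alpha> \<Longrightarrow> \<alpha> n m * \<alpha> p q =
     \<alpha> n m * \<alpha> p (n + m + q) + \<alpha> p q * \<alpha> n (m + p + q) + \<alpha> (n + p) (m + q)"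
  unfolding rb_array_def by blast

lemma vary_power: "vary ^ n = [:monom 1 n:]"
  by (simp add: vary_def poly_const_pow monom_altdef)

lemma scale2_vary_power_inject:
  "scale2 a (vary ^ n) = scale2 b (vary ^ n) \<longleftrightarrow> a = b"
  by (auto simp: scale2_def vary_power smult_monom)

text \<open>
  In the product of two monomials \<open>R\<close> turns every factor into a power of \<open>y\<close> of the same total
  degree, so all four terms of the Rota--Baxter identity are multiples of one power of \<open>y\<close>.
\<close>

lemma rota_baxter_imp_rb_array:
  fixes R :: "'a::field poly poly \<Rightarrow> 'a poly poly"
  assumes rb: "rota_baxter scale2 1 R"
    and R: "\<And>n m. R (varx ^ n * vary ^ m) = scale2 (\<alpha> n m) (vary ^ (n + m))"
  shows "rb_array \<alpha>"
  unfolding rb_array_def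
proof (intro allI)
  fix n m p q :: nat
  interpret R: Vector_Spaces.linear scale2 scale2 R
    using rb by (simp add: rota_baxter_def)
  let ?N = "n + m + p + q"
  let ?M = "\<lambda>i j. varx ^ i * vary ^ j :: 'a poly poly"
  have "scale2 (\<alpha> n m * \<alpha> p q) (vary ^ ?N) = R (?M n m) * R (?M p q)"
    by (simp add: R scale2_def power_add mult_ac)
  also have "\<dots> = R (R (?M n m) * ?M p q + ?M n m * R (?M p q) + scale2 1 (?M n m * ?M p q))"
    using rb by (simp only: rota_baxter_def)
  also have "R (?M n m) * ?M p q + ?M n m * R (?M p q) + scale2 1 (?M n m * ?M p q)
      = scale2 (\<alpha> n m) (?M p (n + m + q)) + scale2 (\<alpha> p q) (?M n (m + p + q))
        + ?M (n + p) (m + q)"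
    unfolding R by (simp add: scale2_conv_const2 const2_def power_add mult_ac flip: one_pCons)
  also have "R \<dots> = scale2 (\<alpha> n m * \<alpha> p (n + m + q) + \<alpha> p q * \<alpha> n (m + p + q)
      + \<alpha> (n + p) (m + q)) (vary ^ ?N)"
    unfolding R.add R.scale R
    by (simp add: R.vs1.scale_left_distrib add_ac)
  finally show "\<alpha> n m * \<alpha> p q =
      \<alpha> n m * \<alpha> p (n + m + q) + \<alpha> p q * \<alpha> n (m + p + q) + \<alpha> (n + p) (m + q)"
    by (simp only: scale2_vary_power_inject)
qed

lemma rb_array_row0_cases:
  fixes \<alpha> :: "nat \<Rightarrow> nat \<Rightarrow> 'a::field"
  assumes "rb_array \<alpha>"
  shows "\<alpha> 0 n = 0 \<or> \<alpha> 0 n = -1"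
proof -
  have "\<alpha> 0 n * (\<alpha> 0 n + 1) = 0"
    using rb_arrayD[OF assms, of 0 0 0 n] by (simp add: algebra_simps)
  then show ?thesis
    by (simp add: eq_neg_iff_add_eq_0)
qed

text \<open>
  Both values of \<open>\<alpha> 0 1\<close> propagate: the recurrence restricted to row \<open>0\<close> says that the index sets
  of the value \<open>0\<close> and of the value \<open>-1\<close> are closed under addition.
\<close>

lemma rb_array_row0_constant:
  fixes \<alpha> :: "nat \<Rightarrow> nat \<Rightarrow> 'a::field"
  assumes "rb_array \<alpha>"
  shows "\<alpha> 0 (Suc n) = \<alpha> 0 1"
proof (induction n)
  case (Suc n)
  have rec: "\<alpha> 0 1 * \<alpha> 0 1 = 2 * (\<alpha> 0 1 * \<alpha> 0 (Suc (Suc n))) + \<alpha> 0 (Suc (Suc n))"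
    using rb_arrayD[OF assms, of 0 1 0 "Suc n"] Suc by simp
  from rb_array_row0_cases[OF assms, of 1] show ?case
  proof
    assume "\<alpha> 0 1 = 0"
    then show ?thesis using rec by simp
  next
    assume "\<alpha> 0 1 = -1"
    then show ?thesis using rec by algebra
  qed
qed simp

lemma rb_array_row1_annihilated:
  fixes \<alpha> :: "nat \<Rightarrow> nat \<Rightarrow> 'a::field"
  assumes "rb_array \<alpha>"
  shows "\<alpha> 1 n * (\<alpha> 0 (Suc n) + 1) = 0"
  using rb_arrayD[OF assms, of 0 0 1 n] by (simp add: algebra_simps)

lemma rb_array_row0:
  fixes \<alpha> :: "nat \<Rightarrow> nat \<Rightarrow> 'a::field"
  assumes "rb_array \<alpha>" and "\<alpha> 1 m \<noteq> 0" and "n > 0"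
  shows "\<alpha> 0 n = -1"
proof -
  have "\<alpha> 0 (Suc m) = -1"
    using rb_array_row1_annihilated[OF assms(1), of m] assms(2)
    by (simp add: eq_neg_iff_add_eq_0)
  then show ?thesis
    using rb_array_row0_constant[OF assms(1)] assms(3) by (metis Suc_pred)
qed

text \<open>
  The entry \<open>\<alpha> 2 (n+1)\<close>, evaluated from \<open>(1,0) + (1,n+1)\<close> and from \<open>(1,1) + (1,n)\<close>, drops out of
  the difference of the two equations.
\<close>

lemma rb_array_row1_recurrence:
  fixes \<alpha> :: "nat \<Rightarrow> nat \<Rightarrow> 'a::comm_ring_1"
  assumes "rb_array \<alpha>"
  shows "(\<alpha> 1 1 + \<alpha> 1 n - \<alpha> 1 0 - \<alpha> 1 (n + 1)) * \<alpha> 1 (n + 2)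
       = \<alpha> 1 1 * \<alpha> 1 n - \<alpha> 1 0 * \<alpha> 1 (n + 1)"
  using rb_arrayD[OF assms, of 1 0 1 "n + 1"] rb_arrayD[OF assms, of 1 1 1 n]
  by (simp add: algebra_simps)

text \<open>
  Odd and even positions are determined alternately, so the induction carries three consecutive
  entries. With \<open>c = \<alpha> 1 0\<close> and \<open>d = \<alpha> 1 1\<close>, the leading coefficient of the recurrence is
  \<open>(n+2)/(n+1) * (d - c)\<close> for \<open>\<alpha> 1 (2*n+3)\<close> and then \<open>(n+1)/(n+2) * (d - c)\<close> for
  \<open>\<alpha> 1 (2*n+4)\<close>; characteristic \<open>0\<close> keeps both nonzero. The denominator of the odd entries is
  cleared in order to stay within polynomial identities.
\<close>

lemma rb_array_row1:
  fixes \<alpha> :: "nat \<Rightarrow> nat \<Rightarrow> 'a::field_char_0"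
  assumes "rb_array \<alpha>" and "\<alpha> 1 2 = \<alpha> 1 0" and "\<alpha> 1 1 \<noteq> \<alpha> 1 0"
  shows "\<alpha> 1 (2 * n) = \<alpha> 1 0 \<and>
         of_nat (n + 1) * \<alpha> 1 (2 * n + 1) = of_nat n * \<alpha> 1 0 + \<alpha> 1 1 \<and>
         \<alpha> 1 (2 * n + 2) = \<alpha> 1 0"
proof (induction n)
  case 0
  then show ?case using assms(2) by (simp del: add_2_eq_Suc add_2_eq_Suc')
next
  case (Suc n)
  define c d s t where "c = \<alpha> 1 0" and "d = \<alpha> 1 1"
    and "s = \<alpha> 1 (2 * n + 1)" and "t = \<alpha> 1 (2 * n + 3)"
  define N :: 'a where "N = of_nat n"
  have nz: "N + 1 \<noteq> 0" "N + 2 \<noteq> 0"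
    unfolding N_def using of_nat_neq_0[of n] of_nat_neq_0[of "Suc n", where 'a = 'a]
    by (simp_all add: algebra_simps)
  have dc: "d - c \<noteq> 0" using assms(3) by (simp add: c_def d_def)
  have s: "(N + 1) * s = N * c + d" and even: "\<alpha> 1 (2 * n + 2) = c"
    using Suc by (simp_all add: N_def s_def c_def d_def add.commute)
  have idx: "2 * Suc n = 2 * n + 2" "2 * n + 1 + 1 = 2 * n + 2" "2 * n + 1 + 2 = 2 * n + 3"
    "2 * n + 2 + 1 = 2 * n + 3" "2 * n + 2 + 2 = 2 * n + 4"
    by simp_all
  have "(d + s - c - c) * t = d * s - c * c"
    using rb_array_row1_recurrence[OF assms(1), of "2 * n + 1"]
    unfolding idx even by (simp only: s_def t_def c_def d_def)
  then have "((N + 1) * d + (N + 1) * s - 2 * (N + 1) * c) * t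
      = d * ((N + 1) * s) - (N + 1) * (c * c)"
    by algebra
  then have "(d - c) * ((N + 2) * t) = (d - c) * ((N + 1) * c + d)"
    unfolding s by algebra
  then have t: "(N + 2) * t = (N + 1) * c + d"
    using dc by simp
  have "(d - t) * \<alpha> 1 (2 * n + 4) = (d - t) * c"
    using rb_array_row1_recurrence[OF assms(1), of "2 * n + 2"]
    unfolding idx even c_def[symmetric] d_def[symmetric] t_def[symmetric]
    by (simp add: algebra_simps)
  moreover have "d - t \<noteq> 0"
  proof
    assume "d - t = 0"
    then have "(N + 1) * (d - c) = 0" using t by algebra
    then show False using nz dc by simp
  qed
  ultimately have even': "\<alpha> 1 (2 * n + 4) = c" by simp
  have "of_nat (Suc n + 1) = N + 2" "of_nat (Suc n) = N + 1"
    by (simp_all add: N_def add.commute)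
  then show ?case
    using t even even' by (simp only: idx t_def c_def d_def)
qed

lemma rb_array_row1_eq:
  fixes \<alpha> :: "nat \<Rightarrow> nat \<Rightarrow> 'a::field_char_0"
  assumes "rb_array \<alpha>" and "\<alpha> 1 2 = \<alpha> 1 0" and "\<alpha> 1 1 \<noteq> \<alpha> 1 0"
  shows "even n \<Longrightarrow> \<alpha> 1 n = \<alpha> 1 0"
    and "odd n \<Longrightarrow> of_nat (n + 1) * \<alpha> 1 n = (of_nat n - 1) * \<alpha> 1 0 + 2 * \<alpha> 1 1"
proof -
  show "\<alpha> 1 n = \<alpha> 1 0" if "even n"
  proof -
    obtain m where "n = 2 * m" using \<open>even n\<close> by (rule evenE)
    then show ?thesis using rb_array_row1[OF assms, of m] by simp
  qed
  assume "odd n"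
  then obtain m where n: "n = 2 * m + 1" by (rule oddE)
  have "of_nat (m + 1) * \<alpha> 1 n = of_nat m * \<alpha> 1 0 + \<alpha> 1 1"
    using rb_array_row1[OF assms, of m] n by simp
  then have "2 * (of_nat (m + 1) * \<alpha> 1 n) = 2 * (of_nat m * \<alpha> 1 0 + \<alpha> 1 1)"
    by simp
  then show "of_nat (n + 1) * \<alpha> 1 n = (of_nat n - 1) * \<alpha> 1 0 + 2 * \<alpha> 1 1"
    by (simp add: n algebra_simps)
qed

lemma eps_eq: "eps k n = (if even (k + n) then 1 else 0)"
proof (cases "even (k + n)")
  case True
  then have "odd (int n - int k - 1)" by simp
  then have "(int n - int k - 1) mod 2 = 1" by (simp only: odd_iff_mod_2_eq_one)
  then show ?thesis using True by (simp add: eps_def)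
next
  case False
  then have "even (int n - int k - 1)" by simp
  then have "(int n - int k - 1) mod 2 = 0" by (simp only: even_iff_mod_2_eq_zero)
  then show ?thesis using False by (simp add: eps_def)
qed

text \<open>
  Let \<open>c = \<alpha> 1 0\<close> and \<open>d = \<alpha> 1 1\<close>. In the recurrence
  \<open>\<alpha> (j+1) n = c * \<alpha> j n - c * \<alpha> j (n+1) - \<alpha> j n * \<alpha> 1 (j+n)\<close> the first and last terms
  cancel for even \<open>j + n\<close>, because then \<open>\<alpha> 1 (j+n) = c\<close>; for odd \<open>j + n\<close> the common factor
  \<open>c ^ j\<close> splits off and a linear form in \<open>c\<close> and \<open>d\<close> remains. Indexing the rows by \<open>Suc k\<close>
  starts the induction at row \<open>1\<close> and keeps truncated subtraction out of the exponents.
\<close>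

lemma rb_array_closed_form:
  fixes \<alpha> :: "nat \<Rightarrow> nat \<Rightarrow> 'a::field_char_0"
  assumes "rb_array \<alpha>" and "\<alpha> 1 2 = \<alpha> 1 0" and "\<alpha> 1 1 \<noteq> \<alpha> 1 0"
  shows "\<alpha> (Suc k) n =
    (if even (k + n) then (-1) ^ k * \<alpha> 1 0 ^ Suc k
     else (-1) ^ k * \<alpha> 1 0 ^ k *
       (((of_nat n - of_nat (Suc k)) * \<alpha> 1 0 + 2 * of_nat (Suc k) * \<alpha> 1 1) / of_nat (n + Suc k)))"
proof (induction k arbitrary: n)
  case 0
  show ?case
    using rb_array_row1_eq[OF assms, of n] of_nat_neq_0[of n, where 'a = 'a]
    by (auto simp: nonzero_eq_divide_eq mult.commute)
next
  case (Suc k)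
  define c d where "c = \<alpha> 1 0" and "d = \<alpha> 1 1"
  note IH = Suc[of n] Suc[of "Suc n"]
  have rec: "\<alpha> (Suc (Suc k)) n =
      c * \<alpha> (Suc k) n - c * \<alpha> (Suc k) (Suc n) - \<alpha> (Suc k) n * \<alpha> 1 (Suc k + n)"
    using rb_arrayD[OF assms(1), of 1 0 "Suc k" n] by (simp add: c_def algebra_simps)
  show ?case
  proof (cases "even (Suc k + n)")
    case True
    then have "\<alpha> 1 (Suc k + n) = c"
      using rb_array_row1_eq(1)[OF assms] by (simp only: c_def)
    then show ?thesis
      using rec IH True by (simp add: c_def)
  next
    case False
    define D K N :: 'a where "D = of_nat (n + Suc (Suc k))" and "K = of_nat k" and "N = of_nat n"
    have D: "D \<noteq> 0" "D = N + K + 2"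
      unfolding D_def K_def N_def
      by (simp_all only: add_Suc_right of_nat_neq_0 not_False_eq_True) simp
    have r1: "D * \<alpha> 1 (Suc k + n) = (N + K) * c + 2 * d"
      using rb_array_row1_eq(2)[OF assms False]
      by (simp add: D_def K_def N_def c_def d_def add_ac)
    then have r1': "\<alpha> 1 (Suc k + n) = ((N + K) * c + 2 * d) / D"
      using D by (simp add: field_simps)
    have a: "\<alpha> (Suc k) n = (-1) ^ k * c ^ Suc k"
      using IH(1) False by (simp add: c_def)
    have b: "\<alpha> (Suc k) (Suc n) = (-1) ^ k * c ^ k * (((N - K) * c + 2 * (K + 1) * d) / D)"
      using IH(2) False by (simp add: c_def d_def D_def N_def K_def add_ac)
    have "\<alpha> (Suc (Suc k)) n = (-1) ^ k * c ^ Suc k *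
        (c - ((N - K) * c + 2 * (K + 1) * d) / D - ((N + K) * c + 2 * d) / D)"
      unfolding rec a b r1' by (simp add: algebra_simps)
    also have "c - ((N - K) * c + 2 * (K + 1) * d) / D - ((N + K) * c + 2 * d) / D
        = - (((N - (K + 2)) * c + 2 * (K + 2) * d) / D)"
    proof -
      have "c * D - ((N - K) * c + 2 * (K + 1) * d) - ((N + K) * c + 2 * d)
          = - ((N - (K + 2)) * c + 2 * (K + 2) * d)"
        unfolding D(2) by algebra
      then show ?thesis
        using D(1) by (simp add: divide_simps)
    qed
    finally show ?thesis
      using False by (simp add: c_def d_def D_def N_def K_def add_ac)
  qed
qed

theorem lemma7p3:
  fixes R :: "'a::field_char_0 poly poly \<Rightarrow> 'a poly poly"
    and \<alpha> :: "nat \<Rightarrow> nat \<Rightarrow> 'a"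
  assumes "rota_baxter scale2 1 R"
    and "\<And>n m. R (varx ^ n * vary ^ m) = scale2 (\<alpha> n m) (vary ^ (n + m))"
    and "\<not> range R \<subseteq> range const2"
    and "\<alpha> 1 0 = \<alpha> 1 2"
    and "\<alpha> 1 2 \<noteq> \<alpha> 1 1"
  shows "(\<forall>k\<ge>1. \<forall>n. R (varx ^ k * vary ^ n) =
            scale2 ((- 1) ^ (k + 1) * \<alpha> 1 0 ^ (k - eps k n) *
                    (((of_nat n - of_nat k) * \<alpha> 1 0 + 2 * of_nat k * \<alpha> 1 1) / of_nat (n + k))
                      ^ eps k n)
              (vary ^ (k + n)))
       \<and> (\<forall>n>0. R (vary ^ n) = - (vary ^ n))"
proof -
  have rb: "rb_array \<alpha>"
    by (rule rota_baxter_imp_rb_array[OF assms(1,2)])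
  have row1: "\<alpha> 1 2 = \<alpha> 1 0" "\<alpha> 1 1 \<noteq> \<alpha> 1 0"
    using assms(4,5) by auto
  have coeff: "\<alpha> k n = (- 1) ^ (k + 1) * \<alpha> 1 0 ^ (k - eps k n) *
      (((of_nat n - of_nat k) * \<alpha> 1 0 + 2 * of_nat k * \<alpha> 1 1) / of_nat (n + k)) ^ eps k n"
    if "k \<ge> 1" for k n
  proof -
    obtain j where k: "k = Suc j" using \<open>k \<ge> 1\<close> by (cases k) auto
    show ?thesis
      unfolding k rb_array_closed_form[OF rb row1] eps_eq by simp
  qed
  have row0: "R (vary ^ n) = - (vary ^ n)" if "n > 0" for n
  proof -
    \<comment> \<open>Row \<open>1\<close> is nonzero because it takes two distinct values.\<close>
    obtain m where "\<alpha> 1 m \<noteq> 0" using row1 by metis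
    then have "\<alpha> 0 n = -1"
      by (rule rb_array_row0[OF rb _ that])
    interpret vector_space "scale2 :: 'a \<Rightarrow> 'a poly poly \<Rightarrow> 'a poly poly"
      by (rule vector_space_scale2)
    have "R (vary ^ n) = scale2 (- 1) (vary ^ n)"
      using assms(2)[of 0 n] \<open>\<alpha> 0 n = -1\<close> by simp
    then show ?thesis
      by (simp only: scale_minus_left scale_one)
  qed
  show ?thesis
  proof (intro conjI allI impI)
    fix k n :: nat
    assume "1 \<le> k"
    then show "R (varx ^ k * vary ^ n) =
        scale2 ((- 1) ^ (k + 1) * \<alpha> 1 0 ^ (k - eps k n) *
          (((of_nat n - of_nat k) * \<alpha> 1 0 + 2 * of_nat k * \<alpha> 1 1) / of_nat (n + k)) ^ eps k n)
        (vary ^ (k + n))"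
      by (simp only: assms(2) coeff[of k n])
  qed (rule row0)
qed

end
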